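(* Let $G=\langle A\,|\,R\rangle$ be an infinite group given by a finite presentation, and let $S=A\cup A^{-1}$. If the Dehn function of $G$ with respect to the presentation $\langle A\,|\,R\rangle$ is strongly-super-polynomial, then $G$ does not admit a quasigeodesic normal form satisfying the $f(n)$-fellow traveler property; that is, for no function $f\in\mathcal F$ with $f\ll\mathfrak i$ does there exist a quasigeodesic normal form $L\subseteq S^*$ of $G$ satisfying the $f(n)$-fellow traveler property.
   Context: Setting. $A=\{a_1,\dots,a_m\}$ is a finite set of symbols representing elements generating $G$; distinct symbols may represent equal elements and some may represent the identity $e$. $A^{-1}$ is the set of formal inverses and $S=A\cup A^{-1}$. $S^*$ is the set of finite words over $S$, $|w|$ is the length of $w$, and $\pi:S^*\to G$ is the canonical projection (evaluation) map. $d_A(g_1,g_2)$ is the length of a shortest word $u\in S^*$ with $\pi(u)=g_1^{-1}g_2$, and $d_A(g)=d_A(e,g)$. Normal form. A language $L\subseteq S^*$ defines a normal form of $G$ if the restriction $\pi|_L:L\to G$ is a bijection. Quasigeodesic. A normal form $L$ is quasigeodesic if there is a constant $C>0$ such that $|w|\leqslant C(d_A(\pi(w))+1)$ for every $w\in L$. Functions. $\mathbb N$ includes $0$; $[N,+\infty)=\{n\in\mathbb N: n\geqslant N\}$; $\mathbb R_+=\{x\in\mathbb R: x\geqslant 0\}$. $\mathcal F$ is the set of all nondecreasing functions $[N,+\infty)\to\mathbb R_+$, for any $N\in\mathbb N$. For $f,h\in\mathcal F$, $h\preceq f$ means there exist positive integers $K,M$ and a nonnegative integer $N$ such that $h(n)\leqslant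 Kf(Mn)$ for all $n\in[N,+\infty)$. $h\ll f$ means there is an unbounded $t\in\mathcal F$ with $ht\preceq f$ (pointwise product on the common domain). $\mathfrak i(n)=n$. A non-zero function $f\in\mathcal F$ is strongly-super-polynomial if $n^2f\ll f$. Fellow traveler property. For a word $w$ and $t\in\mathbb N$, $w(t)$ is the prefix of $w$ of length $t$ if $t\leqslant|w|$, and $w(t)=w$ if $t>|w|$. For a normal form $L$ put $$s(n)=\max\{d_A(\pi(w_1(t)),\pi(w_2(t))) : t\in\mathbb N,\ t\leqslant n,\ w_1,w_2\in L,\ a\in A,\ \pi(w_1)a=\pi(w_2)\}.$$ For $f\in\mathcal F$ with $f\ll\mathfrak i$, $L$ satisfies the $f(n)$-fellow traveler property if $s\preceq f$. Dehn function. $F_A$ is the free group on $A$. For a reduced word $w\in F_A$ with $\pi(w)=e$, the area $\mathcal A(w)$ is the minimum $N$ such that $w=\prod_{i=1}^N\tau_i^{-1}r_i^{\pm1}\tau_i$ in $F_A$ with $r_i\in R$, $\tau_i\in F_A$. The Dehn function with respect to $\langle A\,|\,R\rangle$ is $\delta(n)=\max\{\mathcal A(w): w\in F_A,\ \pi(w)=e,\ |w|\leqslant n\}$, $n\in\mathbb N$. *)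

theory Defs
  imports Complex_Main "HOL-Algebra.Generated_Groups"
begin

section \<open>Words and free groups\<close>

text \<open>A letter is a symbol with a sign: \<open>(a, True)\<close> stands for \<open>a\<close> and
  \<open>(a, False)\<close> for the formal inverse of \<open>a\<close>.\<close>

type_synonym 'a word = "('a \<times> bool) list"

definition letters :: "'a set \<Rightarrow> ('a \<times> bool) set" where
  "letters A = A \<times> UNIV"

definition words :: "'a set \<Rightarrow> 'a word set" where
  "words A = lists (letters A)"

definition flip :: "'a \<times> bool \<Rightarrow> 'a \<times> bool" where
  "flip x = (fst x, \<not> snd x)"

definition reduced :: "'a word \<Rightarrow> bool" where
  "reduced w \<longleftrightarrow> successively (\<lambda>x y. y \<noteq> flip x) w"

fun cons_red :: "'a \<times> bool \<Rightarrow> 'a word \<Rightarrow> 'a word" where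
  "cons_red x [] = [x]"
| "cons_red x (y # w) = (if y = flip x then w else x # y # w)"

definition reduce :: "'a word \<Rightarrow> 'a word" where
  "reduce w = foldr cons_red w []"

definition free_group :: "'a set \<Rightarrow> 'a word monoid" where
  "free_group A = \<lparr>carrier = {w \<in> words A. reduced w},
                   mult = (\<lambda>u v. reduce (u @ v)), one = []\<rparr>"

lemma flip_flip [simp]: "flip (flip x) = x"
  by (simp add: flip_def)

lemma flip_neq [simp]: "flip x \<noteq> x" "x \<noteq> flip x"
  by (auto simp: flip_def prod_eq_iff)

lemma flip_in_letters [simp]: "flip x \<in> letters A \<longleftrightarrow> x \<in> letters A"
  by (auto simp: flip_def letters_def mem_Times_iff)

lemma reduced_Nil [simp]: "reduced []"
  by (simp add: reduced_def)

lemma reduced_ConsD: "reduced (x # w) \<Longrightarrow> reduced w"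
  by (cases w) (auto simp: reduced_def)

lemma reduced_cons_red: "reduced w \<Longrightarrow> reduced (cons_red x w)"
  by (cases w) (auto simp: reduced_def dest: reduced_ConsD[unfolded reduced_def])

lemma reduced_foldr: "reduced v \<Longrightarrow> reduced (foldr cons_red u v)"
  by (induction u) (auto intro: reduced_cons_red)

lemma reduced_reduce [simp]: "reduced (reduce w)"
  by (simp add: reduce_def reduced_foldr)

lemma cons_red_cancel: "reduced w \<Longrightarrow> cons_red x (cons_red (flip x) w) = w"
proof (cases w)
  case (Cons y v)
  assume "reduced w"
  then show ?thesis using Cons by (cases v) (auto simp: reduced_def)
qed simp

lemma foldr_cons_red:
  assumes "reduced v"
  shows "foldr cons_red (cons_red x w) v = cons_red x (foldr cons_red w v)"
  by (cases w) (auto simp: cons_red_cancel reduced_foldr assms)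

lemma foldr_reduce: "reduced v \<Longrightarrow> foldr cons_red (reduce w) v = foldr cons_red w v"
  by (induction w) (auto simp: reduce_def foldr_cons_red)

lemma reduce_id: "reduced w \<Longrightarrow> reduce w = w"
proof (induction w)
  case (Cons x w)
  then have "reduce w = w" by (auto dest: reduced_ConsD)
  then show ?case using Cons.prems
    by (cases w) (auto simp: reduce_def reduced_def)
qed (simp add: reduce_def)

lemma reduce_append: "reduce (u @ v) = foldr cons_red u (reduce v)"
  by (simp add: reduce_def)

lemma reduce_append_reduce [simp]:
  "reduce (reduce u @ v) = reduce (u @ v)" "reduce (u @ reduce v) = reduce (u @ v)"
  by (simp_all add: reduce_append foldr_reduce reduce_id)

lemma cons_red_words: "x \<in> letters A \<Longrightarrow> w \<in> words A \<Longrightarrow> cons_red x w \<in> words A"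
  by (cases w) (auto simp: words_def)

lemma reduce_words: "w \<in> words A \<Longrightarrow> reduce w \<in> words A"
proof (induction w)
  case (Cons x w)
  then have "x \<in> letters A" "reduce w \<in> words A" by (auto simp: words_def)
  then show ?case using cons_red_words by (simp add: reduce_def)
qed (simp add: reduce_def)

lemma append_words: "u @ v \<in> words A \<longleftrightarrow> u \<in> words A \<and> v \<in> words A"
  by (auto simp: words_def)

lemma reduce_flip: "reduce (rev (map flip w) @ w) = []"
proof (induction w)
  case (Cons x w)
  have "reduce (rev (map flip (x # w)) @ x # w)
      = foldr cons_red (rev (map flip w)) (cons_red (flip x) (cons_red x (reduce w)))"
    by (simp add: reduce_def)
  also have "\<dots> = foldr cons_red (rev (map flip w)) (reduce w)"
    using cons_red_cancel[of "reduce w" "flip x"] by simp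
  finally show ?case using Cons.IH by (simp add: reduce_append)
qed (simp add: reduce_def)

lemma group_free_group: "group (free_group A)"
proof (rule groupI, goal_cases)
  case (3 x y z)
  have "reduce (reduce (x @ y) @ z) = reduce (x @ reduce (y @ z))"
    by simp
  then show ?case by (simp add: free_group_def)
next
  case (5 x)
  then have "rev (map flip x) \<in> words A"
    by (auto simp: free_group_def words_def)
  then have "reduce (rev (map flip x)) \<in> carrier (free_group A)"
    by (simp add: free_group_def reduce_words)
  moreover have "reduce (reduce (rev (map flip x)) @ x) = []"
    by (simp add: reduce_flip)
  ultimately show ?case
    by (intro bexI[of _ "reduce (rev (map flip x))"]) (simp_all add: free_group_def)
next
  case 2
  show ?case by (simp add: free_group_def words_def)
qed (auto simp: free_group_def append_words reduce_words reduce_id)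


section \<open>Evaluation of words and word metric\<close>

text \<open>\<open>\<iota> a\<close> is the group element represented by the symbol \<open>a\<close>; \<open>\<iota>\<close> need not be injective
  on the set of symbols and may take the value \<open>\<one>\<close>.\<close>

definition letter_eval :: "('g, 'b) monoid_scheme \<Rightarrow> ('a \<Rightarrow> 'g) \<Rightarrow> 'a \<times> bool \<Rightarrow> 'g" where
  "letter_eval G \<iota> x = (if snd x then \<iota> (fst x) else inv\<^bsub>G\<^esub> \<iota> (fst x))"

definition word_eval :: "('g, 'b) monoid_scheme \<Rightarrow> ('a \<Rightarrow> 'g) \<Rightarrow> 'a word \<Rightarrow> 'g" where
  "word_eval G \<iota> w = foldr (\<lambda>x g. letter_eval G \<iota> x \<otimes>\<^bsub>G\<^esub> g) w \<one>\<^bsub>G\<^esub>"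

definition word_dist ::
  "('g, 'b) monoid_scheme \<Rightarrow> 'a set \<Rightarrow> ('a \<Rightarrow> 'g) \<Rightarrow> 'g \<Rightarrow> 'g \<Rightarrow> nat" where
  "word_dist G A \<iota> g h =
     (LEAST n. \<exists>u \<in> words A. word_eval G \<iota> u = inv\<^bsub>G\<^esub> g \<otimes>\<^bsub>G\<^esub> h \<and> length u = n)"

definition word_norm :: "('g, 'b) monoid_scheme \<Rightarrow> 'a set \<Rightarrow> ('a \<Rightarrow> 'g) \<Rightarrow> 'g \<Rightarrow> nat" where
  "word_norm G A \<iota> g = word_dist G A \<iota> \<one>\<^bsub>G\<^esub> g"

context group
begin

lemma letter_eval_closed:
  "\<iota> \<in> A \<rightarrow> carrier G \<Longrightarrow> x \<in> letters A \<Longrightarrow> letter_eval G \<iota> x \<in> carrier G"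
  by (auto simp: letter_eval_def letters_def)

lemma letter_eval_flip:
  "\<iota> \<in> A \<rightarrow> carrier G \<Longrightarrow> x \<in> letters A \<Longrightarrow> letter_eval G \<iota> (flip x) = inv letter_eval G \<iota> x"
  by (auto simp: letter_eval_def letters_def flip_def Pi_iff)

lemma word_eval_closed:
  "\<iota> \<in> A \<rightarrow> carrier G \<Longrightarrow> w \<in> words A \<Longrightarrow> word_eval G \<iota> w \<in> carrier G"
proof (induction w)
  case (Cons x w)
  then have "x \<in> letters A" "word_eval G \<iota> w \<in> carrier G" by (auto simp: words_def)
  then show ?case using Cons.prems letter_eval_closed[of \<iota> A x] by (simp add: word_eval_def)
qed (simp add: word_eval_def)

lemma word_eval_append:
  "\<iota> \<in> A \<rightarrow> carrier G \<Longrightarrow> u \<in> words A \<Longrightarrow> v \<in> words A \<Longrightarrow>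
   word_eval G \<iota> (u @ v) = word_eval G \<iota> u \<otimes> word_eval G \<iota> v"
proof (induction u)
  case Nil
  then show ?case using word_eval_closed[of \<iota> A v] by (simp add: word_eval_def)
next
  case (Cons x u)
  then show ?case
    using word_eval_closed[of \<iota> A v] word_eval_closed[of \<iota> A u] letter_eval_closed[of \<iota> A x]
    by (auto simp: word_eval_def words_def m_assoc)
qed

lemma word_eval_cons_red:
  assumes "\<iota> \<in> A \<rightarrow> carrier G" "x \<in> letters A" "w \<in> words A"
  shows "word_eval G \<iota> (cons_red x w) = letter_eval G \<iota> x \<otimes> word_eval G \<iota> w"
proof (cases w)
  case (Cons y v)
  then have "v \<in> words A" using assms by (auto simp: words_def)
  then show ?thesis
    using Cons assms letter_eval_closed[of \<iota> A x] word_eval_closed[of \<iota> A v]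
    by (auto simp: word_eval_def letter_eval_flip m_assoc[symmetric])
qed (simp add: word_eval_def)

lemma word_eval_reduce:
  "\<iota> \<in> A \<rightarrow> carrier G \<Longrightarrow> w \<in> words A \<Longrightarrow> word_eval G \<iota> (reduce w) = word_eval G \<iota> w"
proof (induction w)
  case (Cons x w)
  then have "x \<in> letters A" "w \<in> words A" by (auto simp: words_def)
  moreover have "reduce (x # w) = cons_red x (reduce w)" by (simp add: reduce_def)
  ultimately show ?case
    using Cons by (simp add: word_eval_cons_red[where A = A] reduce_words) (simp add: word_eval_def)
qed (simp add: reduce_def)

lemma word_eval_hom: "\<iota> \<in> A \<rightarrow> carrier G \<Longrightarrow> word_eval G \<iota> \<in> hom (free_group A) G"
  by (rule homI)
    (auto simp: free_group_def word_eval_closed word_eval_reduce append_words word_eval_append)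

end


section \<open>Presentations and Dehn functions\<close>

definition normal_closure :: "('h, 'b) monoid_scheme \<Rightarrow> 'h set \<Rightarrow> 'h set" where
  "normal_closure H R = \<Inter> {N. N \<lhd> H \<and> R \<subseteq> N}"

definition finite_presentation ::
  "('g, 'b) monoid_scheme \<Rightarrow> 'a set \<Rightarrow> ('a \<Rightarrow> 'g) \<Rightarrow> 'a word set \<Rightarrow> bool" where
  "finite_presentation G A \<iota> R \<longleftrightarrow>
     group G \<and> finite A \<and> \<iota> \<in> A \<rightarrow> carrier G \<and>
     finite R \<and> R \<subseteq> carrier (free_group A) \<and>
     word_eval G \<iota> ` carrier (free_group A) = carrier G \<and>
     kernel (free_group A) G (word_eval G \<iota>) = normal_closure (free_group A) R"

definition relator_conjugates :: "'a set \<Rightarrow> 'a word set \<Rightarrow> 'a word set" where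
  "relator_conjugates A R =
     (let F = free_group A in
       {inv\<^bsub>F\<^esub> \<tau> \<otimes>\<^bsub>F\<^esub> (r [^]\<^bsub>F\<^esub> \<epsilon>) \<otimes>\<^bsub>F\<^esub> \<tau> | \<tau> r \<epsilon>.
          \<tau> \<in> carrier F \<and> r \<in> R \<and> \<epsilon> \<in> {1, - 1 :: int}})"

definition area :: "'a set \<Rightarrow> 'a word set \<Rightarrow> 'a word \<Rightarrow> nat" where
  "area A R w =
     (LEAST N. \<exists>cs. length cs = N \<and> set cs \<subseteq> relator_conjugates A R \<and>
        w = foldr (\<lambda>c v. c \<otimes>\<^bsub>free_group A\<^esub> v) cs \<one>\<^bsub>free_group A\<^esub>)"

definition dehn ::
  "('g, 'b) monoid_scheme \<Rightarrow> 'a set \<Rightarrow> ('a \<Rightarrow> 'g) \<Rightarrow> 'a word set \<Rightarrow> nat \<Rightarrow> nat" where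
  "dehn G A \<iota> R n =
     Max {area A R w | w. w \<in> carrier (free_group A) \<and> word_eval G \<iota> w = \<one>\<^bsub>G\<^esub> \<and> length w \<le> n}"


section \<open>Comparison of growth\<close>

text \<open>A pair \<open>(N, f)\<close> represents the function \<open>f\<close> restricted to \<open>{N..}\<close>; the values of \<open>f\<close>
  below \<open>N\<close> are irrelevant.\<close>

type_synonym tail_fun = "nat \<times> (nat \<Rightarrow> real)"

definition growth_funs :: "tail_fun set" where
  "growth_funs = {(N, f). mono_on {N..} f \<and> (\<forall>n \<in> {N..}. 0 \<le> f n)}"

definition tail_mult :: "tail_fun \<Rightarrow> tail_fun \<Rightarrow> tail_fun" where
  "tail_mult f h = (max (fst f) (fst h), \<lambda>n. snd f n * snd h n)"

definition tail_unbounded :: "tail_fun \<Rightarrow> bool" where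
  "tail_unbounded f \<longleftrightarrow> (\<forall>B. \<exists>n \<ge> fst f. B < snd f n)"

definition total_fun :: "(nat \<Rightarrow> nat) \<Rightarrow> tail_fun" where
  "total_fun f = (0, \<lambda>n. real (f n))"

text \<open>The first two conjuncts of the body say that both sides of the inequality are defined.\<close>

definition growth_le :: "tail_fun \<Rightarrow> tail_fun \<Rightarrow> bool"  (infix "\<preceq>" 50) where
  "h \<preceq> f \<longleftrightarrow> (\<exists>K M N :: nat. K > 0 \<and> M > 0 \<and>
     (\<forall>n \<ge> N. fst h \<le> n \<and> fst f \<le> M * n \<and> snd h n \<le> real K * snd f (M * n)))"

definition growth_much_less :: "tail_fun \<Rightarrow> tail_fun \<Rightarrow> bool"  (infix "\<lless>" 50) where
  "h \<lless> f \<longleftrightarrow> (\<exists>t \<in> growth_funs. tail_unbounded t \<and> tail_mult h t \<preceq> f)"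

definition strongly_super_polynomial :: "tail_fun \<Rightarrow> bool" where
  "strongly_super_polynomial f \<longleftrightarrow>
     f \<in> growth_funs \<and> (\<exists>n \<ge> fst f. snd f n \<noteq> 0) \<and>
     tail_mult (total_fun (\<lambda>n. n ^ 2)) f \<lless> f"


section \<open>Normal forms\<close>

definition normal_form ::
  "('g, 'b) monoid_scheme \<Rightarrow> 'a set \<Rightarrow> ('a \<Rightarrow> 'g) \<Rightarrow> 'a word set \<Rightarrow> bool" where
  "normal_form G A \<iota> L \<longleftrightarrow> L \<subseteq> words A \<and> bij_betw (word_eval G \<iota>) L (carrier G)"

definition quasigeodesic ::
  "('g, 'b) monoid_scheme \<Rightarrow> 'a set \<Rightarrow> ('a \<Rightarrow> 'g) \<Rightarrow> 'a word set \<Rightarrow> bool" where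
  "quasigeodesic G A \<iota> L \<longleftrightarrow>
     (\<exists>C > 0. \<forall>w \<in> L. real (length w) \<le> C * (real (word_norm G A \<iota> (word_eval G \<iota> w)) + 1))"

definition fellow_traveler_dist ::
  "('g, 'b) monoid_scheme \<Rightarrow> 'a set \<Rightarrow> ('a \<Rightarrow> 'g) \<Rightarrow> 'a word set \<Rightarrow> nat \<Rightarrow> nat" where
  "fellow_traveler_dist G A \<iota> L n =
     Max {word_dist G A \<iota> (word_eval G \<iota> (take t w1)) (word_eval G \<iota> (take t w2)) | t w1 w2 a.
            t \<le> n \<and> w1 \<in> L \<and> w2 \<in> L \<and> a \<in> A \<and>
            word_eval G \<iota> w1 \<otimes>\<^bsub>G\<^esub> \<iota> a = word_eval G \<iota> w2}"

definition fellow_traveler_property ::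
  "('g, 'b) monoid_scheme \<Rightarrow> 'a set \<Rightarrow> ('a \<Rightarrow> 'g) \<Rightarrow> 'a word set \<Rightarrow> tail_fun \<Rightarrow> bool" where
  "fellow_traveler_property G A \<iota> L f \<longleftrightarrow> total_fun (fellow_traveler_dist G A \<iota> L) \<preceq> f"

end

theory Submission
  imports Defs
begin

text \<open>
  Let \<open>\<delta>\<close> be the Dehn function, let \<open>s\<close> be the fellow traveler function of a normal form \<open>L\<close>, and
  suppose that a word of \<open>L\<close> for an element \<open>g\<close> has length at most \<open>C (|g| + 1)\<close>. The theorem comes
  from two estimates of \<open>\<delta>\<close> at a multiple of \<open>m\<close> in terms of \<open>\<delta> m\<close> that contradict each other.

  The upper estimate is the classical filling argument of automatic groups. Cone a loop of length
  \<open>n\<close> off to the identity: join each of its vertices to the identity by the normal form of that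
  vertex. The normal forms have length at most \<open>T = C (n + 1)\<close>, and those of consecutive vertices
  stay within distance \<open>s T\<close> of each other, so they bound a strip that can be cut into \<open>T + 1\<close> loops
  of length at most \<open>2 s T + 2\<close> (lemma \<open>fills_strip\<close>). The \<open>n\<close> strips together fill the loop
  (lemma \<open>dehn_le_fellow_traveler\<close>):
  \<open>\<delta> n \<le> n (C (n + 1) + 1) \<delta> (2 s (C (n + 1)) + 2)\<close>.

  The fellow traveler property with \<open>f(n) \<lless> n\<close> makes \<open>s\<close> sublinear (lemma \<open>sublinear_if_growth_le\<close>).
  Hence for \<open>n = M m\<close> with \<open>M\<close> fixed and \<open>m\<close> large the argument of \<open>\<delta>\<close> on the right is at most \<open>m\<close>,
  and \<open>\<delta> (M m)\<close> is at most a constant times \<open>m\<^sup>2 \<delta> m\<close>. If \<open>\<delta>\<close> were strongly-super-polynomial, then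
  \<open>\<delta> (M m)\<close> would, for some \<open>M\<close>, exceed every constant multiple of \<open>m\<^sup>2 \<delta> m\<close> once
  \<open>m\<close> is large (lemma \<open>not_strongly_super_polynomial\<close>).

  Fillings are handled as words rather than as van Kampen diagrams: \<open>fills A R N w\<close> says that \<open>w\<close> is
  freely equal to a product of at most \<open>N\<close> conjugates of relators. Gluing diagrams becomes the
  insertion of a filled word at any place of another one (lemma \<open>fills_insert\<close>), followed by free
  cancellation along the common boundary.
\<close>

section \<open>Inverse words and conjugates of relators\<close>

definition word_inverse :: "'a word \<Rightarrow> 'a word" where
  "word_inverse w = rev (map flip w)"

lemma length_word_inverse [simp]: "length (word_inverse w) = length w"
  by (simp add: word_inverse_def)

lemma word_inverse_simps [simp]:
  "word_inverse [] = []"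
  "word_inverse (u @ v) = word_inverse v @ word_inverse u"
  "word_inverse (word_inverse w) = w"
  by (simp_all add: word_inverse_def rev_map comp_def)

lemma word_inverse_words [simp]: "word_inverse w \<in> words A \<longleftrightarrow> w \<in> words A"
  by (auto simp: words_def word_inverse_def)

lemma Nil_words [simp]: "[] \<in> words A"
  by (simp add: words_def)

lemma take_words: "w \<in> words A \<Longrightarrow> take n w \<in> words A"
  by (auto simp: words_def dest: in_set_takeD)

lemma drop_words: "w \<in> words A \<Longrightarrow> drop n w \<in> words A"
  by (auto simp: words_def dest: in_set_dropD)

lemma take_Suc_drop: "take (Suc n) w = take n w @ take 1 (drop n w)"
  using take_add[of n 1 w] by simp

lemma length_cons_red: "length (cons_red x w) \<le> Suc (length w)"
  by (cases w) auto

lemma length_reduce: "length (reduce w) \<le> length w"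
proof (induction w)
  case (Cons x w)
  then show ?case
    using length_cons_red[of x "reduce w"] by (simp add: reduce_def)
qed (simp add: reduce_def)

lemma reduce_cancel_left: "reduce (word_inverse p @ p @ w) = reduce w"
proof -
  have "reduce (word_inverse p @ p @ w) = reduce (reduce (word_inverse p @ p) @ w)"
    by simp
  then show ?thesis by (simp add: word_inverse_def reduce_flip)
qed

lemma reduce_cancel: "reduce (u @ word_inverse p @ p @ v) = reduce (u @ v)"
  using reduce_append_reduce(2)[of u "word_inverse p @ p @ v"]
  by (simp add: reduce_cancel_left)

lemma reduce_cancel': "reduce (u @ p @ word_inverse p @ v) = reduce (u @ v)"
  using reduce_cancel[of u "word_inverse p" v] by simp

lemma reduce_carrier: "w \<in> words A \<Longrightarrow> reduce w \<in> carrier (free_group A)"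
  by (simp add: free_group_def reduce_words)

lemma mult_reduce: "reduce u \<otimes>\<^bsub>free_group A\<^esub> reduce v = reduce (u @ v)"
  by (simp add: free_group_def)

lemma one_free_group: "\<one>\<^bsub>free_group A\<^esub> = []"
  by (simp add: free_group_def)

lemma inv_reduce:
  assumes "w \<in> words A"
  shows "inv\<^bsub>free_group A\<^esub> (reduce w) = reduce (word_inverse w)"
proof (rule group.inv_equality[OF group_free_group])
  show "reduce (word_inverse w) \<otimes>\<^bsub>free_group A\<^esub> reduce w = \<one>\<^bsub>free_group A\<^esub>"
    by (simp add: mult_reduce one_free_group word_inverse_def reduce_flip)
qed (use assms in \<open>simp_all add: reduce_carrier\<close>)

abbreviation list_prod :: "('h, 'b) monoid_scheme \<Rightarrow> 'h list \<Rightarrow> 'h" where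
  "list_prod H cs \<equiv> foldr (\<lambda>c v. c \<otimes>\<^bsub>H\<^esub> v) cs \<one>\<^bsub>H\<^esub>"

context group
begin

lemma list_prod_closed: "set cs \<subseteq> carrier G \<Longrightarrow> list_prod G cs \<in> carrier G"
  by (induction cs) auto

lemma list_prod_append:
  "set cs \<subseteq> carrier G \<Longrightarrow> set ds \<subseteq> carrier G \<Longrightarrow>
   list_prod G (cs @ ds) = list_prod G cs \<otimes> list_prod G ds"
  by (induction cs) (auto simp: list_prod_closed m_assoc)

lemma list_prod_conj:
  assumes "\<tau> \<in> carrier G"
  shows "set cs \<subseteq> carrier G \<Longrightarrow>
    list_prod G (map (\<lambda>c. inv \<tau> \<otimes> c \<otimes> \<tau>) cs) = inv \<tau> \<otimes> list_prod G cs \<otimes> \<tau>"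
proof (induction cs)
  case (Cons c cs)
  have p: "list_prod G cs \<in> carrier G" and c: "c \<in> carrier G"
    using Cons.prems by (auto simp: list_prod_closed)
  have "(inv \<tau> \<otimes> c \<otimes> \<tau>) \<otimes> (inv \<tau> \<otimes> list_prod G cs \<otimes> \<tau>)
      = inv \<tau> \<otimes> c \<otimes> (\<tau> \<otimes> inv \<tau>) \<otimes> list_prod G cs \<otimes> \<tau>"
    using assms c p by (simp add: m_assoc del: r_inv Units_r_inv)
  also have "\<dots> = inv \<tau> \<otimes> (c \<otimes> list_prod G cs) \<otimes> \<tau>"
    using assms c p by (simp add: m_assoc)
  finally show ?case using Cons by simp
qed (use assms in simp)

lemma list_prod_inv:
  "set cs \<subseteq> carrier G \<Longrightarrow> inv (list_prod G cs) = list_prod G (rev (map (\<lambda>c. inv c) cs))"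
proof (induction cs)
  case (Cons c cs)
  moreover have "set (rev (map (\<lambda>c. inv c) cs)) \<subseteq> carrier G"
    using Cons.prems by auto
  ultimately show ?case
    by (simp add: inv_mult_group list_prod_closed list_prod_append del: foldr_append)
qed simp

end

lemma relator_conjugates_carrier:
  assumes "R \<subseteq> carrier (free_group A)"
  shows "relator_conjugates A R \<subseteq> carrier (free_group A)"
proof -
  interpret F: group "free_group A" by (rule group_free_group)
  show ?thesis using assms by (auto simp: relator_conjugates_def Let_def)
qed

lemma relator_conjugates_conj:
  assumes "R \<subseteq> carrier (free_group A)" "\<sigma> \<in> carrier (free_group A)"
    and "c \<in> relator_conjugates A R"
  shows "inv\<^bsub>free_group A\<^esub> \<sigma> \<otimes>\<^bsub>free_group A\<^esub> c \<otimes>\<^bsub>free_group A\<^esub> \<sigma> \<in> relator_conjugates A R"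
proof -
  interpret F: group "free_group A" by (rule group_free_group)
  let ?F = "free_group A"
  obtain \<tau> r and \<epsilon> :: int where c: "c = inv\<^bsub>?F\<^esub> \<tau> \<otimes>\<^bsub>?F\<^esub> (r [^]\<^bsub>?F\<^esub> \<epsilon>) \<otimes>\<^bsub>?F\<^esub> \<tau>"
    and \<tau>: "\<tau> \<in> carrier ?F" "r \<in> R" "\<epsilon> \<in> {1, - 1}"
    using assms(3) by (auto simp: relator_conjugates_def Let_def)
  have r: "r \<in> carrier ?F" using \<tau> assms by auto
  have "inv\<^bsub>?F\<^esub> \<sigma> \<otimes>\<^bsub>?F\<^esub> c \<otimes>\<^bsub>?F\<^esub> \<sigma>
      = inv\<^bsub>?F\<^esub> (\<tau> \<otimes>\<^bsub>?F\<^esub> \<sigma>) \<otimes>\<^bsub>?F\<^esub> (r [^]\<^bsub>?F\<^esub> \<epsilon>) \<otimes>\<^bsub>?F\<^esub> (\<tau> \<otimes>\<^bsub>?F\<^esub> \<sigma>)"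
    using \<tau> r assms by (simp add: c F.inv_mult_group F.m_assoc F.int_pow_closed)
  then show ?thesis
    unfolding relator_conjugates_def Let_def using \<tau> assms(2) F.m_closed by blast
qed

lemma relator_conjugates_inv:
  assumes "R \<subseteq> carrier (free_group A)" "c \<in> relator_conjugates A R"
  shows "inv\<^bsub>free_group A\<^esub> c \<in> relator_conjugates A R"
proof -
  interpret F: group "free_group A" by (rule group_free_group)
  let ?F = "free_group A"
  obtain \<tau> r and \<epsilon> :: int where c: "c = inv\<^bsub>?F\<^esub> \<tau> \<otimes>\<^bsub>?F\<^esub> (r [^]\<^bsub>?F\<^esub> \<epsilon>) \<otimes>\<^bsub>?F\<^esub> \<tau>"
    and \<tau>: "\<tau> \<in> carrier ?F" "r \<in> R" "\<epsilon> \<in> {1, - 1}"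
    using assms(2) by (auto simp: relator_conjugates_def Let_def)
  have r: "r \<in> carrier ?F" using \<tau> assms by auto
  have "inv\<^bsub>?F\<^esub> c = inv\<^bsub>?F\<^esub> \<tau> \<otimes>\<^bsub>?F\<^esub> (r [^]\<^bsub>?F\<^esub> (- \<epsilon>)) \<otimes>\<^bsub>?F\<^esub> \<tau>"
    using \<tau> r by (simp add: c F.inv_mult_group F.m_assoc F.int_pow_closed F.int_pow_neg)
  moreover have "- \<epsilon> \<in> {1, - 1}" using \<tau> by auto
  ultimately show ?thesis
    unfolding relator_conjugates_def Let_def using \<tau> by blast
qed

lemma relator_in_relator_conjugates:
  assumes "r \<in> R" "R \<subseteq> carrier (free_group A)"
  shows "r \<in> relator_conjugates A R"
proof -
  interpret F: group "free_group A" by (rule group_free_group)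
  let ?F = "free_group A"
  have "r = inv\<^bsub>?F\<^esub> \<one>\<^bsub>?F\<^esub> \<otimes>\<^bsub>?F\<^esub> (r [^]\<^bsub>?F\<^esub> (1 :: int)) \<otimes>\<^bsub>?F\<^esub> \<one>\<^bsub>?F\<^esub>"
    using assms by (auto simp: F.int_pow_1)
  then show ?thesis
    unfolding relator_conjugates_def Let_def using assms F.one_closed by blast
qed


section \<open>Fillings of words\<close>

text \<open>Stated for all words rather than for reduced ones, so that fillings can be glued by concatenation,
  and with an upper bound rather than an exact count, so that the bounds for different words can be
  made uniform.\<close>

definition fills :: "'a set \<Rightarrow> 'a word set \<Rightarrow> nat \<Rightarrow> 'a word \<Rightarrow> bool" where
  "fills A R N w \<longleftrightarrow> (\<exists>cs. length cs \<le> N \<and> set cs \<subseteq> relator_conjugates A R \<and>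
     reduce w = list_prod (free_group A) cs)"

lemma fills_mono: "fills A R N w \<Longrightarrow> N \<le> M \<Longrightarrow> fills A R M w"
  unfolding fills_def using le_trans by blast

lemma fills_reduce_eq: "fills A R N u \<Longrightarrow> reduce u = reduce v \<Longrightarrow> fills A R N v"
  by (simp add: fills_def)

lemma fills_trivial: "reduce w = [] \<Longrightarrow> fills A R N w"
  unfolding fills_def by (intro exI[of _ "[]"]) (simp add: one_free_group)

lemma area_le_if_fills: "fills A R N w \<Longrightarrow> area A R (reduce w) \<le> N"
proof -
  assume "fills A R N w"
  then obtain cs where cs: "length cs \<le> N" "set cs \<subseteq> relator_conjugates A R"
    "reduce w = list_prod (free_group A) cs"
    by (auto simp: fills_def)
  have "area A R (reduce w) \<le> length cs"
    unfolding area_def by (rule Least_le) (use cs in blast)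
  then show ?thesis using cs(1) by simp
qed

lemma fills_append:
  assumes "R \<subseteq> carrier (free_group A)" "fills A R N u" "fills A R M v"
  shows "fills A R (N + M) (u @ v)"
proof -
  interpret F: group "free_group A" by (rule group_free_group)
  note sub = relator_conjugates_carrier[OF assms(1)]
  obtain cs where cs: "length cs \<le> N" "set cs \<subseteq> relator_conjugates A R"
    "reduce u = list_prod (free_group A) cs"
    using assms(2) by (auto simp: fills_def)
  obtain ds where ds: "length ds \<le> M" "set ds \<subseteq> relator_conjugates A R"
    "reduce v = list_prod (free_group A) ds"
    using assms(3) by (auto simp: fills_def)
  have "reduce (u @ v) = list_prod (free_group A) (cs @ ds)"
  proof -
    have "set cs \<subseteq> carrier (free_group A)" "set ds \<subseteq> carrier (free_group A)"
      using cs(2) ds(2) sub by blast+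
    then show ?thesis
      by (simp only: F.list_prod_append cs(3)[symmetric] ds(3)[symmetric] mult_reduce)
  qed
  then show ?thesis
    unfolding fills_def using cs ds by (intro exI[of _ "cs @ ds"]) auto
qed

lemma fills_conj:
  assumes "R \<subseteq> carrier (free_group A)" "fills A R N w" "p \<in> words A"
  shows "fills A R N (word_inverse p @ w @ p)"
proof -
  interpret F: group "free_group A" by (rule group_free_group)
  let ?F = "free_group A"
  note sub = relator_conjugates_carrier[OF assms(1)]
  obtain cs where cs: "length cs \<le> N" "set cs \<subseteq> relator_conjugates A R"
    "reduce w = list_prod ?F cs"
    using assms(2) by (auto simp: fills_def)
  let ?\<tau> = "reduce p"
  let ?ds = "map (\<lambda>c. inv\<^bsub>?F\<^esub> ?\<tau> \<otimes>\<^bsub>?F\<^esub> c \<otimes>\<^bsub>?F\<^esub> ?\<tau>) cs"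
  have \<tau>: "?\<tau> \<in> carrier ?F" using assms(3) by (rule reduce_carrier)
  have "list_prod ?F ?ds = inv\<^bsub>?F\<^esub> ?\<tau> \<otimes>\<^bsub>?F\<^esub> reduce w \<otimes>\<^bsub>?F\<^esub> ?\<tau>"
    using F.list_prod_conj[OF \<tau>, of cs] cs sub by auto
  also have "\<dots> = reduce (word_inverse p @ w @ p)"
    by (simp add: inv_reduce[OF assms(3)] mult_reduce)
  finally have "reduce (word_inverse p @ w @ p) = list_prod ?F ?ds" ..
  moreover have "set ?ds \<subseteq> relator_conjugates A R"
    using relator_conjugates_conj[OF assms(1) \<tau>] cs(2) by auto
  ultimately show ?thesis
    unfolding fills_def using cs(1) by (intro exI[of _ ?ds]) simp
qed

lemma fills_word_inverse:
  assumes "R \<subseteq> carrier (free_group A)" "fills A R N w" "w \<in> words A"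
  shows "fills A R N (word_inverse w)"
proof -
  interpret F: group "free_group A" by (rule group_free_group)
  let ?F = "free_group A"
  note sub = relator_conjugates_carrier[OF assms(1)]
  obtain cs where cs: "length cs \<le> N" "set cs \<subseteq> relator_conjugates A R"
    "reduce w = list_prod ?F cs"
    using assms(2) by (auto simp: fills_def)
  let ?ds = "rev (map (\<lambda>c. inv\<^bsub>?F\<^esub> c) cs)"
  have "reduce (word_inverse w) = list_prod ?F ?ds"
    using F.list_prod_inv[of cs] cs sub inv_reduce[OF assms(3)] by auto
  moreover have "set ?ds \<subseteq> relator_conjugates A R"
    using relator_conjugates_inv[OF assms(1)] cs(2) by auto
  ultimately show ?thesis
    unfolding fills_def using cs(1) by (intro exI[of _ ?ds]) simp
qed

text \<open>Inserting \<open>w\<close> between \<open>u\<close> and \<open>v\<close> costs no more than filling \<open>w\<close>, because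
  \<open>u w v = (u v) (v\<inverse> w v)\<close> in the free group.\<close>

lemma fills_insert:
  assumes "R \<subseteq> carrier (free_group A)" "fills A R N (u @ v)" "fills A R M w" "v \<in> words A"
  shows "fills A R (N + M) (u @ w @ v)"
proof (rule fills_reduce_eq)
  show "fills A R (N + M) ((u @ v) @ word_inverse v @ w @ v)"
    using assms by (intro fills_append fills_conj)
  show "reduce ((u @ v) @ word_inverse v @ w @ v) = reduce (u @ w @ v)"
    using reduce_cancel'[of u v "w @ v"] by simp
qed

lemma fills_relator:
  assumes "r \<in> R" "R \<subseteq> carrier (free_group A)"
  shows "fills A R 1 r"
proof -
  interpret F: group "free_group A" by (rule group_free_group)
  have r: "r \<in> carrier (free_group A)" using assms by auto
  then have "reduce r = list_prod (free_group A) [r]"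
    by (auto simp: free_group_def reduce_id)
  then show ?thesis
    unfolding fills_def using relator_in_relator_conjugates[OF assms]
    by (intro exI[of _ "[r]"]) simp
qed

text \<open>The words that have a filling form a normal subgroup that contains the relators.\<close>

lemma fills_normal_closure:
  assumes R: "R \<subseteq> carrier (free_group A)" and w: "w \<in> normal_closure (free_group A) R"
  shows "\<exists>N. fills A R N w"
proof -
  interpret F: group "free_group A" by (rule group_free_group)
  let ?F = "free_group A"
  let ?P = "{w \<in> carrier ?F. \<exists>N. fills A R N w}"
  have word: "w \<in> words A" "reduce w = w" if "w \<in> carrier ?F" for w
    using that by (auto simp: free_group_def reduce_id)
  have inv: "inv\<^bsub>?F\<^esub> w = reduce (word_inverse w)" if "w \<in> carrier ?F" for w
    using inv_reduce[of w A] word[OF that] by simp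
  have fr: "fills A R N (reduce u) \<longleftrightarrow> fills A R N u" for N u
    by (simp add: fills_def reduce_id)
  have mul: "u \<otimes>\<^bsub>?F\<^esub> v = reduce (u @ v)" for u v
    by (simp add: free_group_def)
  have sub: "subgroup ?P ?F"
  proof (rule F.subgroupI)
    have "fills A R 0 \<one>\<^bsub>?F\<^esub>"
      by (rule fills_trivial) (simp add: one_free_group reduce_id)
    then show "?P \<noteq> {}" using F.one_closed by blast
  next
    fix a assume "a \<in> ?P"
    then show "inv\<^bsub>?F\<^esub> a \<in> ?P"
      using fills_word_inverse[OF R] word(1) by (auto simp: inv fr reduce_carrier)
  next
    fix a b assume "a \<in> ?P" "b \<in> ?P"
    then obtain N M where ab: "a \<in> carrier ?F" "b \<in> carrier ?F" "fills A R N a" "fills A R M b"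
      by blast
    have "fills A R (N + M) (a \<otimes>\<^bsub>?F\<^esub> b)"
      using fills_append[OF R ab(3,4)] by (simp add: mul fr)
    then show "a \<otimes>\<^bsub>?F\<^esub> b \<in> ?P"
      using F.m_closed[OF ab(1,2)] by blast
  qed auto
  have conj: "inv\<^bsub>?F\<^esub> x \<otimes>\<^bsub>?F\<^esub> h \<otimes>\<^bsub>?F\<^esub> x \<in> ?P" if "x \<in> carrier ?F" "h \<in> ?P" for x h
  proof -
    obtain N where h: "h \<in> carrier ?F" "fills A R N h"
      using \<open>h \<in> ?P\<close> by blast
    have "fills A R N (inv\<^bsub>?F\<^esub> x \<otimes>\<^bsub>?F\<^esub> h \<otimes>\<^bsub>?F\<^esub> x)"
      using fills_conj[OF R h(2) word(1)] \<open>x \<in> carrier ?F\<close> by (simp add: inv mul fr)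
    moreover have "inv\<^bsub>?F\<^esub> x \<otimes>\<^bsub>?F\<^esub> h \<otimes>\<^bsub>?F\<^esub> x \<in> carrier ?F"
      using h(1) \<open>x \<in> carrier ?F\<close> by simp
    ultimately show ?thesis by blast
  qed
  have "x \<otimes>\<^bsub>?F\<^esub> h \<otimes>\<^bsub>?F\<^esub> inv\<^bsub>?F\<^esub> x \<in> ?P" if "x \<in> carrier ?F" "h \<in> ?P" for x h
    using conj[OF F.inv_closed[OF that(1)] that(2)] that(1) by (simp only: F.inv_inv)
  with sub have "?P \<lhd> ?F"
    by (simp add: F.normal_inv_iff)
  moreover have "R \<subseteq> ?P"
    using R fills_relator[OF _ R] by blast
  ultimately show ?thesis
    using w by (auto simp: normal_closure_def)
qed


section \<open>The Dehn function and the fellow traveler function\<close>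

locale presented_group = group G for G :: "('g, 'b) monoid_scheme" (structure) +
  fixes A :: "'a set" and \<iota> :: "'a \<Rightarrow> 'g" and R :: "'a word set"
  assumes presentation: "finite_presentation G A \<iota> R"
begin

abbreviation "ev \<equiv> word_eval G \<iota>"
abbreviation "wdist \<equiv> word_dist G A \<iota>"
abbreviation "\<delta> \<equiv> dehn G A \<iota> R"

lemma finite_A: "finite A"
  and \<iota>: "\<iota> \<in> A \<rightarrow> carrier G"
  and R: "R \<subseteq> carrier (free_group A)"
  and surj: "ev ` carrier (free_group A) = carrier G"
  and ker: "kernel (free_group A) G ev = normal_closure (free_group A) R"
  using presentation by (simp_all add: finite_presentation_def)

lemmas ev_closed [simp] = word_eval_closed[OF \<iota>]
lemmas ev_append = word_eval_append[OF \<iota>]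
lemmas ev_reduce = word_eval_reduce[OF \<iota>]

lemma ev_Nil [simp]: "ev [] = \<one>"
  by (simp add: word_eval_def)

lemma ev_word_inverse:
  assumes "w \<in> words A"
  shows "ev (word_inverse w) = inv (ev w)"
proof -
  have "ev (word_inverse w) \<otimes> ev w = ev (reduce (word_inverse w @ w))"
    using assms by (simp add: ev_append ev_reduce append_words)
  also have "\<dots> = \<one>" by (simp add: word_inverse_def reduce_flip)
  finally show ?thesis using assms inv_equality[of "ev (word_inverse w)" "ev w"] by simp
qed

lemma finite_short_words: "finite {w \<in> words A. length w \<le> n}"
proof -
  have "finite (letters A)" using finite_A by (simp add: letters_def)
  then have "finite {w. set w \<subseteq> letters A \<and> length w \<le> n}"
    by (rule finite_lists_length_le)
  then show ?thesis by (rule rev_finite_subset) (auto simp: words_def)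
qed

lemma finite_areas:
  "finite {area A R w |w. w \<in> carrier (free_group A) \<and> ev w = \<one> \<and> length w \<le> n}"
  by (rule finite_subset[OF _ finite_imageI[OF finite_short_words[of n], of "area A R"]])
    (auto simp: free_group_def)

text \<open>The fact that makes \<open>area\<close> meaningful: without it, the least number in its definition
  could range over the empty set.\<close>

lemma fills_if_trivial:
  assumes "w \<in> words A" "ev w = \<one>"
  shows "\<exists>N. fills A R N w"
proof -
  have "reduce w \<in> kernel (free_group A) G ev"
    using assms by (simp add: kernel_def reduce_carrier ev_reduce)
  then obtain N where "fills A R N (reduce w)"
    using fills_normal_closure[OF R] ker by auto
  then show ?thesis by (auto simp: fills_def reduce_id)
qed

lemma fills_dehn:
  assumes w: "w \<in> words A" "ev w = \<one>" "length w \<le> n"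
  shows "fills A R (\<delta> n) w"
proof -
  let ?P = "\<lambda>N cs. length cs = N \<and> set cs \<subseteq> relator_conjugates A R \<and>
        reduce w = list_prod (free_group A) cs"
  have "\<exists>N cs. ?P N cs" using fills_if_trivial[OF w(1,2)] by (auto simp: fills_def)
  then have "\<exists>cs. ?P (area A R (reduce w)) cs"
    unfolding area_def by (rule LeastI_ex)
  then obtain cs where "?P (area A R (reduce w)) cs" ..
  then have "fills A R (area A R (reduce w)) w"
    unfolding fills_def by (intro exI[of _ cs]) simp
  moreover have "area A R (reduce w) \<le> \<delta> n"
    unfolding dehn_def
  proof (rule Max_ge)
    show "finite {area A R w |w. w \<in> carrier (free_group A) \<and> ev w = \<one> \<and> length w \<le> n}"
      by (rule finite_areas)
    show "area A R (reduce w)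
        \<in> {area A R w |w. w \<in> carrier (free_group A) \<and> ev w = \<one> \<and> length w \<le> n}"
      using w reduce_carrier[of w A] ev_reduce[of w] length_reduce[of w] by force
  qed
  ultimately show ?thesis by (rule fills_mono)
qed

lemma dehn_le:
  assumes "\<And>w. w \<in> words A \<Longrightarrow> ev w = \<one> \<Longrightarrow> length w \<le> n \<Longrightarrow> fills A R N w"
  shows "\<delta> n \<le> N"
  unfolding dehn_def
proof (rule Max.boundedI)
  show "finite {area A R w |w. w \<in> carrier (free_group A) \<and> ev w = \<one> \<and> length w \<le> n}"
    by (rule finite_areas)
  show "{area A R w |w. w \<in> carrier (free_group A) \<and> ev w = \<one> \<and> length w \<le> n} \<noteq> {}"
    by (auto simp: free_group_def intro!: exI[of _ "[]"])
next
  fix a assume "a \<in> {area A R w |w. w \<in> carrier (free_group A) \<and> ev w = \<one> \<and> length w \<le> n}"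
  then obtain w where "a = area A R w" "w \<in> words A" "reduced w" "ev w = \<one>" "length w \<le> n"
    by (auto simp: free_group_def)
  then show "a \<le> N"
    using area_le_if_fills[OF assms, of w] by (simp add: reduce_id)
qed

lemma dehn_mono: "m \<le> n \<Longrightarrow> \<delta> m \<le> \<delta> n"
  by (intro dehn_le fills_dehn) auto

lemma geodesic_word:
  assumes "g \<in> carrier G" "h \<in> carrier G"
  obtains p where "p \<in> words A" "ev p = inv g \<otimes> h" "length p = wdist g h"
proof -
  have "inv g \<otimes> h \<in> ev ` carrier (free_group A)" using assms surj by simp
  then have "\<exists>n. \<exists>u \<in> words A. ev u = inv g \<otimes> h \<and> length u = n"
    unfolding free_group_def by fastforce
  then have "\<exists>u \<in> words A. ev u = inv g \<otimes> h \<and> length u = wdist g h"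
    unfolding word_dist_def by (rule LeastI_ex)
  then show ?thesis using that by blast
qed

lemma word_norm_le: "w \<in> words A \<Longrightarrow> word_norm G A \<iota> (ev w) \<le> length w"
  unfolding word_norm_def word_dist_def by (rule Least_le) auto

lemma fellow_traveler_dist_ge:
  assumes "L \<subseteq> words A" "t \<le> n" "u \<in> L" "v \<in> L" "a \<in> A" "ev u \<otimes> \<iota> a = ev v"
  shows "wdist (ev (take t u)) (ev (take t v)) \<le> fellow_traveler_dist G A \<iota> L n"
  unfolding fellow_traveler_dist_def
proof (rule Max_ge)
  let ?W = "{w \<in> words A. length w \<le> n}"
  let ?D = "{wdist (ev (take t u)) (ev (take t v)) | t u v a.
    t \<le> n \<and> u \<in> L \<and> v \<in> L \<and> a \<in> A \<and> ev u \<otimes> \<iota> a = ev v}"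
  have "?D \<subseteq> (\<lambda>(p, q). wdist (ev p) (ev q)) ` (?W \<times> ?W)"
  proof
    fix d assume "d \<in> ?D"
    then obtain t u v where d: "d = wdist (ev (take t u)) (ev (take t v))" "t \<le> n" "u \<in> L" "v \<in> L"
      by blast
    then have "take t u \<in> ?W" "take t v \<in> ?W" using assms(1) by (auto simp: take_words)
    then show "d \<in> (\<lambda>(p, q). wdist (ev p) (ev q)) ` (?W \<times> ?W)"
      using d(1) by (intro image_eqI[of _ _ "(take t u, take t v)"]) auto
  qed
  then show "finite ?D"
    by (rule finite_subset) (intro finite_imageI finite_cartesian_product finite_short_words)
  show "wdist (ev (take t u)) (ev (take t v)) \<in> ?D" using assms by blast
qed


section \<open>Filling a loop by strips between normal forms\<close>

text \<open>The words \<open>u\<close> and \<open>v\<close> are the long sides of a strip, \<open>x\<close> is its far end, and the words \<open>p\<close>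
  provided by the last hypothesis are its rungs. Two consecutive rungs and the letters of \<open>u\<close> and \<open>v\<close>
  between them form a loop of length at most \<open>2 * D + 2\<close>. The strip is filled rung by rung, starting
  from the empty rung at the common origin.\<close>

lemma fills_strip:
  assumes uv: "u \<in> words A" "v \<in> words A" and x: "x \<in> letters A"
    and eq: "ev u \<otimes> letter_eval G \<iota> x = ev v"
    and len: "length u \<le> T" "length v \<le> T"
    and close: "\<And>t. t \<le> T \<Longrightarrow> \<exists>p \<in> words A. length p \<le> D \<and>
      ev (take t u) \<otimes> ev p = ev (take t v)"
  shows "fills A R ((T + 1) * \<delta> (2 * D + 2)) (u @ [x] @ word_inverse v)"
proof -
  let ?E = "\<delta> (2 * D + 2)"
  have x': "[x] \<in> words A" using x by (simp add: words_def)
  have ev_x: "ev [x] = letter_eval G \<iota> x"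
    using letter_eval_closed[OF \<iota> x] by (simp add: word_eval_def)
  \<comment> \<open>One cell is added: it has the old rung \<open>p\<close>, the new rung \<open>q\<close> and the side pieces \<open>y\<close> and \<open>z\<close>.
    The bounds on lengths also admit \<open>q = [x]\<close> with empty \<open>y\<close> and \<open>z\<close>, even for \<open>D = 0\<close>, which closes
    the strip at its far end.\<close>
  have step: "fills A R (N + ?E) ((U @ y) @ q @ word_inverse (V @ z))"
    if "fills A R N (U @ p @ word_inverse V)" "U \<in> words A" "V \<in> words A" "p \<in> words A"
      "q \<in> words A" "y \<in> words A" "z \<in> words A" "length p \<le> D"
      "length y + length z + length q \<le> D + 2"
      "ev U \<otimes> ev p = ev V" "ev (U @ y) \<otimes> ev q = ev (V @ z)" for N U V p q y z
  proof (rule fills_reduce_eq)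
    let ?l = "word_inverse p @ y @ q @ word_inverse z"
    have l: "?l \<in> words A" using that by (simp add: append_words)
    note cl = that(2-7)[THEN ev_closed]
    have "ev U \<otimes> (ev y \<otimes> ev q) = ev V \<otimes> ev z"
      using that(11) cl by (simp only: ev_append[OF that(2,6)] ev_append[OF that(3,7)] m_assoc)
    also have "\<dots> = ev U \<otimes> (ev p \<otimes> ev z)"
      using cl by (simp only: that(10)[symmetric] m_assoc)
    finally have yq: "ev y \<otimes> ev q = ev p \<otimes> ev z"
      using cl by (simp only: Units_l_cancel Units_eq m_closed)
    have "ev ?l = inv (ev p) \<otimes> ((ev y \<otimes> ev q) \<otimes> inv (ev z))"
      using that(2-7) by (simp add: ev_append append_words ev_word_inverse m_assoc)
    also have "\<dots> = \<one>"
      unfolding yq using cl by (simp add: m_assoc)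
    finally have "ev ?l = \<one>" .
    then have "fills A R ?E ?l"
      using that l by (intro fills_dehn) auto
    then show "fills A R (N + ?E) ((U @ p) @ ?l @ word_inverse V)"
      using that by (intro fills_insert[OF R]) auto
    show "reduce ((U @ p) @ ?l @ word_inverse V) = reduce ((U @ y) @ q @ word_inverse (V @ z))"
      using reduce_cancel'[of U p "y @ q @ word_inverse z @ word_inverse V"] by simp
  qed
  have "\<exists>p \<in> words A. length p \<le> D \<and> ev (take t u) \<otimes> ev p = ev (take t v) \<and>
      fills A R (t * ?E) (take t u @ p @ word_inverse (take t v))" if "t \<le> T" for t
    using that
  proof (induction t)
    case 0
    show ?case by (intro bexI[of _ "[]"]) (auto intro: fills_trivial simp: reduce_def)
  next
    case (Suc t)
    then obtain p where p: "p \<in> words A" "length p \<le> D" "ev (take t u) \<otimes> ev p = ev (take t v)"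
      "fills A R (t * ?E) (take t u @ p @ word_inverse (take t v))" by auto
    obtain q where q: "q \<in> words A" "length q \<le> D" "ev (take (Suc t) u) \<otimes> ev q = ev (take (Suc t) v)"
      using close[OF Suc.prems] by blast
    define y z where "y = take 1 (drop t u)" and "z = take 1 (drop t v)"
    have yz: "take (Suc t) u = take t u @ y" "take (Suc t) v = take t v @ z"
      unfolding y_def z_def by (rule take_Suc_drop)+
    have "length y \<le> 1" "length z \<le> 1" "y \<in> words A" "z \<in> words A"
      using uv by (simp_all add: y_def z_def take_words drop_words)
    then have "fills A R (t * ?E + ?E) ((take t u @ y) @ q @ word_inverse (take t v @ z))"
      using p q uv by (intro step[OF p(4)]) (simp_all add: take_words flip: yz)
    then show ?case using q
      by (intro bexI[of _ q]) (simp_all add: add.commute flip: yz)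
  qed
  from this[of T] obtain p where p: "p \<in> words A" "length p \<le> D" "ev u \<otimes> ev p = ev v"
    "fills A R (T * ?E) (u @ p @ word_inverse v)"
    using len by auto
  have "fills A R (T * ?E + ?E) ((u @ []) @ [x] @ word_inverse (v @ []))"
    using p uv x' eq by (intro step[OF p(4)]) (auto simp: ev_x)
  then show ?thesis by (simp add: algebra_simps)
qed

text \<open>The induction goes along the loop \<open>w\<close>: the first \<open>i\<close> strips fill the loop that follows the normal
  form of \<open>1\<close>, then \<open>i\<close> letters of \<open>w\<close>, and returns along the normal form of the vertex reached.
  After the last letter this vertex is \<open>1\<close> again, so what is filled is a conjugate of \<open>w\<close>.\<close>

lemma dehn_le_fellow_traveler:
  assumes nf: "normal_form G A \<iota> L"
    and qg: "\<And>w. w \<in> L \<Longrightarrow> length w \<le> C * (word_norm G A \<iota> (ev w) + 1)"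
  shows "\<delta> n \<le> n * (C * (n + 1) + 1) * \<delta> (2 * fellow_traveler_dist G A \<iota> L (C * (n + 1)) + 2)"
proof (rule dehn_le)
  fix w assume w: "w \<in> words A" "ev w = \<one>" "length w \<le> n"
  let ?T = "C * (n + 1)"
  let ?D = "fellow_traveler_dist G A \<iota> L ?T"
  let ?E = "(?T + 1) * \<delta> (2 * ?D + 2)"
  have L: "L \<subseteq> words A" and bij: "bij_betw ev L (carrier G)"
    using nf by (auto simp: normal_form_def)
  define nrm where "nrm g = the_inv_into L ev g" for g
  have nrm: "nrm g \<in> L" "ev (nrm g) = g" if "g \<in> carrier G" for g
    using that bij unfolding nrm_def
    by (auto simp: bij_betw_def f_the_inv_into_f intro: the_inv_into_into)
  define u where "u i = nrm (ev (take i w))" for i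
  have u: "u i \<in> L" "ev (u i) = ev (take i w)" "u i \<in> words A" for i
    using nrm[of "ev (take i w)"] w L by (auto simp: u_def take_words)
  have len: "length (u i) \<le> ?T" for i
  proof -
    have "length (u i) \<le> C * (word_norm G A \<iota> (ev (take i w)) + 1)"
      using qg[OF u(1)[of i]] u(2)[of i] by simp
    also have "\<dots> \<le> C * (n + 1)"
      using word_norm_le[of "take i w"] w by (intro mult_le_mono2) (auto simp: take_words)
    finally show ?thesis .
  qed
  have path: "\<exists>p \<in> words A. length p \<le> ?D \<and> ev (take t y) \<otimes> ev p = ev (take t z)"
    if "y \<in> L" "z \<in> L" "a \<in> A" "ev y \<otimes> \<iota> a = ev z" "t \<le> ?T" for y z a t
  proof -
    have yz: "take t y \<in> words A" "take t z \<in> words A" using that L by (auto simp: take_words)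
    then obtain p where "p \<in> words A" "ev p = inv (ev (take t y)) \<otimes> ev (take t z)"
      "length p = wdist (ev (take t y)) (ev (take t z))"
      using geodesic_word by (metis ev_closed)
    then show ?thesis
      using fellow_traveler_dist_ge[OF L that(5,1-4)] yz
      by (intro bexI[of _ p]) (auto simp: m_assoc[symmetric])
  qed
  have "fills A R (i * ?E) (u 0 @ take i w @ word_inverse (u i))" if "i \<le> length w" for i
    using that
  proof (induction i)
    case 0
    show ?case using reduce_cancel'[of "[]" "u 0" "[]"]
      by (auto intro!: fills_trivial simp: reduce_def)
  next
    case (Suc i)
    define x where "x = w ! i"
    have x: "x \<in> letters A" using w Suc.prems by (auto simp: x_def words_def)
    have x': "[x] \<in> words A" using x by (simp add: words_def)
    have tk: "take (Suc i) w = take i w @ [x]"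
      using Suc.prems by (simp add: x_def take_Suc_conv_app_nth)
    have ev_x: "ev [x] = letter_eval G \<iota> x"
      using letter_eval_closed[OF \<iota> x] by (simp add: word_eval_def)
    have eq: "ev (u i) \<otimes> letter_eval G \<iota> x = ev (u (Suc i))"
      using w x' by (simp add: u tk ev_append take_words ev_x)
    have ax: "fst x \<in> A" using x by (auto simp: letters_def)
    have close: "\<exists>p \<in> words A. length p \<le> ?D \<and>
        ev (take t (u i)) \<otimes> ev p = ev (take t (u (Suc i)))" if "t \<le> ?T" for t
    proof (cases "snd x")
      case True
      then show ?thesis
        using path[OF u(1) u(1) ax _ that] eq by (simp add: letter_eval_def)
    next
      case False
      \<comment> \<open>The fellow traveler function only compares \<open>g\<close> with \<open>g a\<close> for generators \<open>a\<close>. For an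
        inverse letter the two normal forms exchange their roles, and the rungs are reversed.\<close>
      have "\<iota> (fst x) \<in> carrier G" using ax \<iota> by auto
      then have "ev (u (Suc i)) \<otimes> \<iota> (fst x) = ev (u i)"
        using eq False u(3) by (simp add: letter_eval_def m_assoc flip: eq)
      from path[OF u(1) u(1) ax this that]
      obtain p where p: "p \<in> words A" "length p \<le> ?D"
        "ev (take t (u (Suc i))) \<otimes> ev p = ev (take t (u i))"
        by blast
      then have "ev (take t (u i)) \<otimes> ev (word_inverse p) = ev (take t (u (Suc i)))"
        using u(3) by (simp add: ev_word_inverse m_assoc take_words flip: p(3))
      then show ?thesis using p by (intro bexI[of _ "word_inverse p"]) auto
    qed
    have "fills A R ?E (u i @ [x] @ word_inverse (u (Suc i)))"
      using fills_strip[OF u(3) u(3) x eq len len close] by blast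
    then have "fills A R (i * ?E + ?E) ((u 0 @ take i w @ word_inverse (u i))
        @ (u i @ [x] @ word_inverse (u (Suc i))) @ [])"
      using Suc by (intro fills_insert[OF R]) auto
    then have "fills A R (i * ?E + ?E) (u 0 @ take (Suc i) w @ word_inverse (u (Suc i)))"
      by (rule fills_reduce_eq)
        (use reduce_cancel[of "u 0 @ take i w" "u i" "[x] @ word_inverse (u (Suc i))"] in
          \<open>simp add: tk\<close>)
    then show ?case by (simp add: add.commute)
  qed
  from this[of "length w"] have "fills A R (length w * ?E) (u 0 @ w @ word_inverse (u 0))"
    using w by (simp add: u_def)
  from fills_conj[OF R this u(3)[of 0]]
  have "fills A R (length w * ?E) w"
    by (rule fills_reduce_eq)
      (use reduce_cancel[of "[]" "u 0" "w @ word_inverse (u 0) @ u 0"]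
        reduce_cancel[of w "u 0" "[]"] in simp)
  then show "fills A R (n * (?T + 1) * \<delta> (2 * ?D + 2)) w"
    by (rule fills_mono) (use w(3) in \<open>simp only: mult.assoc mult_le_mono1\<close>)
qed

end


section \<open>Sublinear fellow traveler functions and the growth of the Dehn function\<close>

lemma tail_unbounded_eventually:
  assumes "t \<in> growth_funs" "tail_unbounded t"
  obtains n0 where "n0 \<ge> fst t" "\<And>n. n \<ge> n0 \<Longrightarrow> B < snd t n"
proof -
  obtain n0 where n0: "n0 \<ge> fst t" "B < snd t n0"
    using assms(2) by (auto simp: tail_unbounded_def)
  have "snd t n0 \<le> snd t n" if "n \<ge> n0" for n
    using assms(1) n0 that by (auto simp: growth_funs_def mono_on_def split: prod.splits)
  then show ?thesis using n0 that by force
qed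

text \<open>If \<open>f n * t n\<close> is at most linear with \<open>t\<close> unbounded, then \<open>f\<close> is at most linear with an
  arbitrarily small slope; the dilation and the factor hidden in \<open>\<preceq>\<close> only change the slope by a
  constant.\<close>

lemma sublinear_if_growth_le:
  assumes "total_fun s \<preceq> f" "f \<lless> total_fun (\<lambda>n. n)" "f \<in> growth_funs" "\<epsilon> > 0"
  shows "\<exists>n0. \<forall>n \<ge> n0. real (s n) \<le> \<epsilon> * real n"
proof -
  obtain K M N :: nat where KM: "K > 0" "M > 0"
    and s: "\<And>n. n \<ge> N \<Longrightarrow> fst f \<le> M * n \<and> real (s n) \<le> real K * snd f (M * n)"
    using assms(1) by (auto simp: growth_le_def total_fun_def)
  obtain t where t: "t \<in> growth_funs" "tail_unbounded t"
    and "tail_mult f t \<preceq> total_fun (\<lambda>n. n)"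
    using assms(2) by (auto simp: growth_much_less_def)
  then obtain K' M' N' :: nat where KM': "K' > 0" "M' > 0"
    and f: "\<And>n. n \<ge> N' \<Longrightarrow> snd f n * snd t n \<le> real K' * real (M' * n)"
    by (auto simp: growth_le_def total_fun_def tail_mult_def)
  \<comment> \<open>The lower bound on \<open>t\<close> that turns the slope \<open>K K' M' M\<close> into \<open>\<epsilon>\<close>.\<close>
  define B where "B = real (K * K' * M' * M) / \<epsilon>"
  have B: "B > 0" using KM KM' assms(4) by (simp add: B_def)
  obtain n0 where n0: "\<And>n. n \<ge> n0 \<Longrightarrow> B < snd t n"
    using tail_unbounded_eventually[OF t, of B] by blast
  have "real (s n) \<le> \<epsilon> * real n" if n: "n \<ge> Max {N, N', n0}" for n
  proof -
    have n': "n \<ge> N" "n \<ge> N'" "n \<ge> n0" using n by auto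
    have "n \<le> M * n" using KM by simp
    then have Mn: "M * n \<ge> N'" "M * n \<ge> n0" using n' by linarith+
    have f0: "0 \<le> snd f (M * n)"
      using assms(3) s[OF n'(1)] by (auto simp: growth_funs_def)
    have "real (s n) * B \<le> real K * snd f (M * n) * B"
      using s[OF n'(1)] B by (intro mult_right_mono) auto
    also have "\<dots> \<le> real K * snd f (M * n) * snd t (M * n)"
      using n0[OF Mn(2)] f0 by (intro mult_left_mono) auto
    also have "\<dots> \<le> real K * (real K' * real (M' * (M * n)))"
      using f[OF Mn(1)] by (simp add: mult.assoc mult_left_mono)
    also have "\<dots> = (\<epsilon> * real n) * B"
      using assms(4) by (simp add: B_def)
    finally show ?thesis using B by simp
  qed
  then show ?thesis by blast
qed

text \<open>At \<open>n = M m\<close> the recursion bounds \<open>\<delta> (M m)\<close> by a constant times \<open>m\<^sup>2 \<delta> m\<close> as soon as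
  \<open>2 s (C (M m + 1)) + 2 \<le> m\<close>, and sublinearity of \<open>s\<close> provides this for all large \<open>m\<close>. The
  definition of strong super-polynomiality bounds \<open>\<delta> (M m)\<close> from below by a constant times
  \<open>m\<^sup>2 \<delta> m t(m)\<close> with \<open>t\<close> unbounded.\<close>

lemma not_strongly_super_polynomial:
  fixes \<delta> s :: "nat \<Rightarrow> nat"
  assumes mono: "mono \<delta>"
    and rec: "\<And>n. \<delta> n \<le> n * (C * (n + 1) + 1) * \<delta> (2 * s (C * (n + 1)) + 2)"
    and sub: "\<And>\<epsilon>. \<epsilon> > 0 \<Longrightarrow> \<exists>n0. \<forall>n \<ge> n0. real (s n) \<le> \<epsilon> * real n"
    and C: "C > 0"
  shows "\<not> strongly_super_polynomial (total_fun \<delta>)"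
proof
  assume "strongly_super_polynomial (total_fun \<delta>)"
  then obtain n1 t where n1: "\<delta> n1 > 0" and t: "t \<in> growth_funs" "tail_unbounded t"
    and "tail_mult (tail_mult (total_fun (\<lambda>n. n ^ 2)) (total_fun \<delta>)) t \<preceq> total_fun \<delta>"
    by (auto simp: strongly_super_polynomial_def growth_much_less_def total_fun_def)
  then obtain K M N :: nat where KM: "K > 0" "M > 0"
    and low: "\<And>m. m \<ge> N \<Longrightarrow> real (m ^ 2) * real (\<delta> m) * snd t m \<le> real K * real (\<delta> (M * m))"
    by (auto simp: growth_le_def total_fun_def tail_mult_def)
  \<comment> \<open>The upper bound on \<open>t m\<close> that results from the two estimates.\<close>
  define B where "B = real (K * (M\<^sup>2 * (2 * C + 1)))"
  obtain n2 where n2: "\<And>n. n \<ge> n2 \<Longrightarrow> B < snd t n"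
    using tail_unbounded_eventually[OF t, of B] by blast
  \<comment> \<open>Since \<open>C (M m + 1) \<le> 2 C M m\<close>, this slope gives \<open>s (C (M m + 1)) \<le> m / 4\<close>, and then
    \<open>2 s (C (M m + 1)) + 2 \<le> m\<close> for \<open>m \<ge> 4\<close>.\<close>
  obtain n3 where n3: "\<And>n. n \<ge> n3 \<Longrightarrow> real (s n) \<le> 1 / real (8 * C * M) * real n"
    using sub[of "1 / real (8 * C * M)"] KM C by auto
  define m where "m = Max {N, n1, n2, n3, 4}"
  have m: "m \<ge> N" "m \<ge> n1" "m \<ge> n2" "m \<ge> n3" "m \<ge> 4" by (auto simp: m_def)
  let ?n = "M * m"
  have nm: "?n \<ge> m" using KM by simp
  let ?k = "C * (?n + 1)"
  have k_le: "?k \<le> C * (2 * ?n)" using nm m by (intro mult_le_mono2) linarith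
  have "n3 \<le> ?n + 1" using nm m(4) by linarith
  also have "\<dots> = 1 * (?n + 1)" by simp
  also have "\<dots> \<le> ?k" using C by (intro mult_le_mono1) simp
  finally have "?k \<ge> n3" .
  then have "real (s ?k) \<le> 1 / real (8 * C * M) * real ?k" by (rule n3)
  also have "\<dots> \<le> 1 / real (8 * C * M) * real (C * (2 * ?n))"
    by (rule mult_left_mono[OF of_nat_mono[OF k_le]]) simp
  also have "\<dots> = real m / 4" using KM C by simp
  finally have "2 * s ?k + 2 \<le> m" using m by linarith
  then have \<delta>_le: "\<delta> (2 * s ?k + 2) \<le> \<delta> m" using mono by (simp add: monoD)
  have "?n * (C * (?n + 1) + 1) \<le> ?n * (?n * (2 * C + 1))"
  proof (rule mult_le_mono2)
    have "1 \<le> ?n" using nm m by linarith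
    with k_le have "C * (?n + 1) + 1 \<le> C * (2 * ?n) + ?n" by (rule add_mono)
    also have "\<dots> = ?n * (2 * C + 1)" by algebra
    finally show "C * (?n + 1) + 1 \<le> ?n * (2 * C + 1)" .
  qed
  then have "\<delta> ?n \<le> ?n * (?n * (2 * C + 1)) * \<delta> m"
    using rec[of ?n] \<delta>_le by (meson mult_le_mono order_trans)
  then have up: "real (\<delta> ?n) \<le> real (?n * (?n * (2 * C + 1)) * \<delta> m)"
    by (rule of_nat_mono)
  have \<delta>m: "\<delta> m > 0" using n1 monoD[OF mono m(2)] by linarith
  have "(real (m ^ 2) * real (\<delta> m)) * snd t m \<le> real K * real (\<delta> ?n)"
    using low[OF m(1)] .
  also have "\<dots> \<le> real K * real (?n * (?n * (2 * C + 1)) * \<delta> m)"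
    using up by (intro mult_left_mono) auto
  also have "\<dots> = (real (m ^ 2) * real (\<delta> m)) * B"
    by (simp only: B_def power2_eq_square of_nat_mult mult_ac)
  finally have "snd t m \<le> B" using \<delta>m m(5) by simp
  then show False using n2[OF m(3)] by simp
qed

theorem theorem14:
  fixes G :: "('g, 'b) monoid_scheme"
    and A :: "'a set"
    and \<iota> :: "'a \<Rightarrow> 'g"
    and R :: "'a word set"
  assumes "finite_presentation G A \<iota> R"
    and "infinite (carrier G)"
    and "strongly_super_polynomial (total_fun (dehn G A \<iota> R))"
  shows "\<not> (\<exists>f \<in> growth_funs. f \<lless> total_fun (\<lambda>n. n) \<and>
           (\<exists>L. normal_form G A \<iota> L \<and> quasigeodesic G A \<iota> L \<and>
                fellow_traveler_property G A \<iota> L f))"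
proof
  assume "\<exists>f \<in> growth_funs. f \<lless> total_fun (\<lambda>n. n) \<and>
           (\<exists>L. normal_form G A \<iota> L \<and> quasigeodesic G A \<iota> L \<and>
                fellow_traveler_property G A \<iota> L f)"
  then obtain f L where f: "f \<in> growth_funs" "f \<lless> total_fun (\<lambda>n. n)"
    and nf: "normal_form G A \<iota> L" and qg: "quasigeodesic G A \<iota> L"
    and ft: "total_fun (fellow_traveler_dist G A \<iota> L) \<preceq> f"
    by (auto simp: fellow_traveler_property_def)
  interpret presented_group G A \<iota> R
    using assms(1)
    by (auto simp: presented_group_def presented_group_axioms_def finite_presentation_def)
  obtain C' where C': "C' > 0"
    "\<And>w. w \<in> L \<Longrightarrow> real (length w) \<le> C' * (real (word_norm G A \<iota> (ev w)) + 1)"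
    using qg by (auto simp: quasigeodesic_def)
  define C where "C = nat \<lceil>C'\<rceil>"
  have C: "C > 0" "C' \<le> real C" using C'(1) by (auto simp: C_def)
  have "length w \<le> C * (word_norm G A \<iota> (ev w) + 1)" if "w \<in> L" for w
  proof -
    note C'(2)[OF that]
    also have "C' * (real (word_norm G A \<iota> (ev w)) + 1)
        \<le> real C * (real (word_norm G A \<iota> (ev w)) + 1)"
      using C(2) by (intro mult_right_mono) auto
    also have "\<dots> = real (C * (word_norm G A \<iota> (ev w) + 1))"
      by (simp add: algebra_simps)
    finally show ?thesis by (simp only: of_nat_le_iff)
  qed
  from dehn_le_fellow_traveler[OF nf this]
  have "\<not> strongly_super_polynomial (total_fun \<delta>)"
    using sublinear_if_growth_le[OF ft f(2,1)] C(1) dehn_mono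
    by (intro not_strongly_super_polynomial[where s = "fellow_traveler_dist G A \<iota> L"] monoI) auto
  then show False using assms(3) by contradiction
qed

end
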